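(* Let $k\geq 2$ and $n$ be positive integers and let $a_1<a_2<\cdots<a_k$ be positive integers satisfying $\frac{n}{2^{n}}=\sum_{i=1}^{k}\frac{a_{i}}{2^{a_{i}}}$. Then $$a_k\leq 2n+2k\log_2 k.$$
   Context: The equation $\frac{n}{2^{n}}=\sum_{i=1}^{k}\frac{a_{i}}{2^{a_{i}}}$ is considered in positive integers $n,k,a_1,\ldots,a_k$ with $k\geq 2$ and $a_1<\cdots<a_k$. *)

theory Defs
  imports Complex_Main
begin

end

theory Submission imports Defs "HOL-Analysis.Convex" "HOL-Analysis.Harmonic_Numbers" begin

text \<open>
  Let \<open>T j\<close> be the sum of the terms with index at least \<open>j\<close>. Comparison with the full series
  gives \<open>T (j + 1) < 2 (a (j + 1) + 1) / 2 ^ a (j + 1)\<close>, while \<open>T (j + 1)\<close> is a positive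
  integer multiple of \<open>2 ^ - a j\<close>. Hence each gap \<open>a (j + 1) - a j\<close> is at most
  \<open>1 + log 2 (a k)\<close>, and the last one at most \<open>log 2 (a k)\<close>. Since \<open>a 1 = n + 1\<close> for
  \<open>n \<ge> 3\<close> and \<open>a 2 \<le> 6\<close> for \<open>n \<le> 2\<close>, adding up the gaps bounds \<open>A = a k\<close> by a multiple of
  \<open>log 2 A\<close>; replacing the logarithm by its tangent line at \<open>4 k\<close> (for \<open>k < 16\<close>) or \<open>8 k\<close>
  (for \<open>k \<ge> 16\<close>) solves this inequality for \<open>A\<close>.
\<close>

section \<open>Sums of \<open>x / 2 ^ x\<close>\<close>

text \<open>The sum telescopes, since \<open>x / 2 ^ x\<close> is the drop of
  \<open>(x + 2) / 2 ^ x\<close> from \<open>x - 1\<close> to \<open>x\<close>.\<close>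

lemma sum_nat_div_power2:
  assumes "m \<le> N"
  shows "(\<Sum>x=m..N. real x / 2 ^ x) = 2 * real (m + 1) / 2 ^ m - real (N + 2) / 2 ^ N"
  using assms
proof (induction N rule: dec_induct)
  case base
  then show ?case by (simp add: field_simps)
next
  case (step N)
  have "real (N + 2) / 2 ^ N = real (Suc N) / 2 ^ Suc N + real (Suc N + 2) / 2 ^ Suc N"
    by (simp add: field_simps)
  with step show ?case by simp
qed

lemma sum_nat_div_power2_less:
  assumes "finite S" "\<And>x. x \<in> S \<Longrightarrow> m \<le> x"
  shows "(\<Sum>x\<in>S. real x / 2 ^ x) < 2 * real (m + 1) / 2 ^ m"
proof -
  define N where "N = Max (insert m S)"
  have "S \<subseteq> {m..N}" using assms by (auto simp: N_def)
  then have "(\<Sum>x\<in>S. real x / 2 ^ x) \<le> (\<Sum>x=m..N. real x / 2 ^ x)"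
    by (intro sum_mono2) auto
  also have "\<dots> = 2 * real (m + 1) / 2 ^ m - real (N + 2) / 2 ^ N"
    by (rule sum_nat_div_power2) (use assms in \<open>auto simp: N_def\<close>)
  also have "\<dots> < 2 * real (m + 1) / 2 ^ m" by simp
  finally show ?thesis .
qed

text \<open>One step doubles the denominator but at most doubles the numerator. The case
  \<open>c = 0\<close> compares single terms, the case \<open>c = 1\<close> compares tail
  bounds.\<close>

lemma nat_add_div_power2_antimono:
  assumes "x \<le> y" "x + c \<ge> 1"
  shows "real (y + c) / 2 ^ y \<le> real (x + c) / 2 ^ x"
  using assms
proof (induction y rule: dec_induct)
  case base
  then show ?case by simp
next
  case (step y)
  then have "real (Suc y + c) \<le> 2 * real (y + c)" by simp
  then have "real (Suc y + c) / 2 ^ Suc y \<le> 2 * real (y + c) / 2 ^ Suc y"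
    by (intro divide_right_mono) auto
  also have "\<dots> = real (y + c) / 2 ^ y" by (simp add: field_simps)
  finally have "real (Suc y + c) / 2 ^ Suc y \<le> real (y + c) / 2 ^ y" .
  with step show ?case by linarith
qed

section \<open>Linear bounds for the binary logarithm\<close>

text \<open>The tangent at \<open>c\<close> has slope \<open>1 / (c * ln 2)\<close>; the rational
  bounds 36/25 \<le> \<open>1 / ln 2\<close> \<le> 3/2 make its coefficients rational.\<close>

lemma log2_le_tangent:
  fixes A c :: real
  assumes "A > 0" "c > 0"
  shows "log 2 A \<le> log 2 c + 3/2 * (A / c) - 36/25"
proof -
  have ln2: "2/3 \<le> ln (2::real)" "ln (2::real) \<le> 25/36" "ln (2::real) > 0"
    using ln2_ge_two_thirds ln2_le_25_over_36 by auto
  define y where "y = A / c"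
  define q where "q = 1 / ln (2::real)"
  have "log 2 A = log 2 c + ln y / ln 2"
    using assms by (simp add: y_def log_def ln_div diff_divide_distrib)
  moreover have "ln y \<le> y - 1"
    using assms by (intro ln_le_minus_one) (auto simp: y_def)
  then have "ln y / ln 2 \<le> y * q - q"
    using ln2(3) by (simp add: q_def divide_simps)
  moreover have "y * q \<le> y * (3/2)"
    using assms ln2 by (intro mult_left_mono) (auto simp: y_def q_def field_simps)
  moreover have "q \<ge> 36/25" using ln2 by (simp add: q_def field_simps)
  ultimately have "log 2 A \<le> log 2 c + 3/2 * y - 36/25" by linarith
  then show ?thesis by (simp add: y_def)
qed

text \<open>A concave function lies above its chord, here the one between consecutive powers of 2.
  In exponential form this is \<open>2 powr t\<close> \<le> \<open>1 + t\<close> on the unit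
  interval, from convexity of \<open>exp\<close>.\<close>

lemma log2_ge_chord:
  fixes k :: nat
  assumes "2 ^ j \<le> k" "k \<le> 2 ^ Suc j"
  shows "real j - 1 + real k / 2 ^ j \<le> log 2 (real k)"
proof -
  define t where "t = real k / 2 ^ j - 1"
  have k0: "real k > 0" using assms(1) by (cases k) auto
  have "real (2 ^ j) \<le> real k" "real k \<le> real (2 ^ Suc j)" using assms by (metis of_nat_le_iff)+
  then have t: "0 \<le> t" "t \<le> 1" by (auto simp: t_def field_simps)
  have "exp ((1 - t) *\<^sub>R 0 + t *\<^sub>R ln 2) \<le> (1 - t) * exp 0 + t * exp (ln (2::real))"
    using t by (intro convex_onD[OF exp_convex]) auto
  then have "2 powr t \<le> 1 + t" by (simp add: powr_def)
  then have "t \<le> log 2 (1 + t)" using t by (simp add: le_log_iff)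
  also have "\<dots> = log 2 (real k) - real j"
    using k0 by (simp add: t_def log_divide)
  finally show ?thesis by (simp add: t_def)
qed

section \<open>Solving the inequality between \<open>A\<close> and \<open>log 2 A\<close>\<close>

text \<open>The tangent at \<open>r * k\<close> makes \<open>A_le\<close> linear in
  \<open>A\<close>. Collected on the left, \<open>A\<close> has positive coefficients, so the lower
  bound \<open>A_gt\<close> can replace it, leaving an inequality in \<open>k\<close>,
  \<open>n\<close> and \<open>L\<close> to be refuted.\<close>

lemma large_solution_imp_bound:
  fixes A b n s r :: real and k :: nat
  defines "L \<equiv> log 2 (real k)"
  assumes "k > 0" "A > 0" "0 < s" "s \<le> real k" "2 \<le> r" "0 \<le> n"
    and A_le: "A \<le> b + (real k - s) * log 2 A"
    and A_gt: "A > 2 * n + 2 * real k * L"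
  shows "(1 - 3 / (2 * r)) * (2 * n + 2 * real k * L) + 3 * s * L / r
           < b + (real k - s) * (L + log 2 r - 36/25)"
proof -
  have "log 2 A \<le> log 2 (r * real k) + 3/2 * (A / (r * real k)) - 36/25"
    using assms by (intro log2_le_tangent) auto
  then have "log 2 A \<le> L + log 2 r - 36/25 + 3/2 * (A / (r * real k))"
    using assms by (simp add: log_mult)
  then have "(real k - s) * log 2 A
      \<le> (real k - s) * (L + log 2 r - 36/25 + 3/2 * (A / (r * real k)))"
    using assms by (intro mult_left_mono) auto
  also have "\<dots> = (real k - s) * (L + log 2 r - 36/25) + 3 / (2 * r) * A
                     - 3 * s / (2 * r) * (A / real k)"
    using assms by (simp add: field_simps)
  finally have *: "(1 - 3 / (2 * r)) * A + 3 * s / (2 * r) * (A / real k)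
      \<le> b + (real k - s) * (L + log 2 r - 36/25)"
    using A_le by (simp add: algebra_simps)
  \<comment> \<open>For the small term in \<open>A / k\<close> the part \<open>2 * n\<close> is
    given up, which avoids a quotient \<open>n / k\<close>.\<close>
  have "2 * real k * L < A" using A_gt \<open>0 \<le> n\<close> by linarith
  then have "2 * L < A / real k" using \<open>k > 0\<close> by (simp add: field_simps)
  then have "3 * s / (2 * r) * (2 * L) < 3 * s / (2 * r) * (A / real k)"
    using assms by (intro mult_strict_left_mono) auto
  moreover have "(1 - 3 / (2 * r)) * (2 * n + 2 * real k * L) \<le> (1 - 3 / (2 * r)) * A"
    using A_gt \<open>2 \<le> r\<close> by (intro mult_left_mono) (auto simp: field_simps)
  moreover have "3 * s / (2 * r) * (2 * L) = 3 * s * L / r" by simp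
  ultimately show ?thesis using * by linarith
qed

text \<open>Below 16 the refutation is tight and needs the chords; from 16 on constant lower bounds
  for \<open>L\<close> are enough.\<close>

lemma log2_of_nat_cases:
  fixes k :: nat
  assumes "k \<ge> 2"
  defines "L \<equiv> log 2 (real k)"
  obtains "k < 16" "k \<le> 4 \<longrightarrow> real k / 2 \<le> L"
    "4 \<le> k \<and> k \<le> 8 \<longrightarrow> 1 + real k / 4 \<le> L" "8 \<le> k \<longrightarrow> 2 + real k / 8 \<le> L"
  | "k \<ge> 16" "k \<le> 128" "L \<ge> 4"
  | "k > 128" "L \<ge> 7"
proof -
  have ge: "L \<ge> real j" if "2 ^ j \<le> k" for j
  proof -
    have "real (2 ^ j) \<le> real k" using that by (metis of_nat_le_iff)
    then show ?thesis using assms by (simp add: le_log_iff powr_realpow)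
  qed
  consider "k < 16" | "16 \<le> k" "k \<le> 128" | "k > 128" by linarith
  then show thesis
  proof cases
    case 1
    then show thesis
      using log2_ge_chord[of 1 k] log2_ge_chord[of 2 k] log2_ge_chord[of 3 k] assms
      by (intro that(1)) simp_all
  next
    case 2
    then show thesis using ge[of 4] by (intro that(2)) auto
  next
    case 3
    then show thesis using ge[of 7] by (intro that(3)) auto
  qed
qed

lemma bound_of_log_inequality_large:
  fixes A n :: real and k :: nat
  assumes "k \<ge> 2" "n \<ge> 3" "A > 0"
    and "A \<le> n + real k - 1 + (real k - 1) * log 2 A"
  shows "A \<le> 2 * n + 2 * real k * log 2 (real k)"
proof (rule ccontr)
  define L where "L = log 2 (real k)"
  assume neg: "\<not> ?thesis"
  note E = large_solution_imp_bound[of k A 1 _ n "n + real k - 1", folded L_def]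
  have log48: "log 2 (4::real) = 2" "log 2 (8::real) = 3"
    using log_of_power_eq[of 4 2 2] log_of_power_eq[of 8 2 3] by auto
  \<comment> \<open>Here 14/25 = 2 - 36/25, and 39/25 = 3 - 36/25 for \<open>r = 8\<close>.
    \<open>E4\<close> serves \<open>k < 16\<close> and \<open>E8\<close> the rest.\<close>
  have E4: "5/8 * (2 * n + 2 * real k * L) + 3/4 * L < n + real k - 1 + (real k - 1) * (L + 14/25)"
    using E[of 4] assms neg by (simp add: log48 L_def add.commute)
  have "13/16 * (2 * n + 2 * real k * L) + 3/8 * L < n + real k - 1 + (real k - 1) * (L + 39/25)"
    using E[of 8] assms neg by (simp add: log48 L_def add.commute)
  then have E8: "5/8 * n + 5/8 * (real k * L) + 11/8 * L < 64/25 * (real k - 1)"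
    by (simp add: field_simps)
  show False
    using \<open>k \<ge> 2\<close>
  proof (cases k rule: log2_of_nat_cases)
    case 1
    \<comment> \<open>For a numeral \<open>k\<close> the product \<open>k * L\<close> becomes
      linear, so \<open>E4\<close> contradicts the chord bound by linear arithmetic.\<close>
    then have "k = 2 \<or> k = 3 \<or> k = 4 \<or> k = 5 \<or> k = 6 \<or> k = 7 \<or> k = 8 \<or> k = 9 \<or> k = 10 \<or> k = 11
      \<or> k = 12 \<or> k = 13 \<or> k = 14 \<or> k = 15"
      using \<open>k \<ge> 2\<close> by presburger
    then show False
      using 1(2-) E4 \<open>n \<ge> 3\<close> unfolding L_def[symmetric]
      by (elim disjE) (simp_all add: field_simps)
  next
    case 2
    \<comment> \<open>The coefficient 5/2 of \<open>k\<close> falls short of 64/25 by 3/50. For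
      \<open>k\<close> \<le> 128 this costs less than 8, while the constants in \<open>E8\<close>
      contribute more than 9.\<close>
    have "real k * 4 \<le> real k * L" using 2 by (intro mult_left_mono) (auto simp: L_def)
    moreover have "L \<ge> 4" "real k \<le> 128" using 2 by (auto simp: L_def)
    ultimately show False using E8 \<open>n \<ge> 3\<close> by argo
  next
    case 3
    \<comment> \<open>Now the coefficient 35/8 of \<open>k\<close> exceeds 64/25 outright.\<close>
    have "real k * 7 \<le> real k * L" using 3 by (intro mult_left_mono) (auto simp: L_def)
    moreover have "L \<ge> 7" "real k > 128" using 3 by (auto simp: L_def)
    ultimately show False using E8 \<open>n \<ge> 3\<close> by argo
  qed
qed

text \<open>Serves \<open>n = 1\<close> and \<open>n = 2\<close> together through the stronger bound
  for \<open>n = 1\<close>. The gaps are added from \<open>a 2\<close> on, which leaves only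
  \<open>k - 2\<close> logarithms.\<close>

lemma bound_of_log_inequality_small:
  fixes A :: real and k :: nat
  assumes "k \<ge> 3" "A > 0"
    and "A \<le> real k + 3 + (real k - 2) * log 2 A"
  shows "A \<le> 2 + 2 * real k * log 2 (real k)"
proof (rule ccontr)
  define L where "L = log 2 (real k)"
  assume neg: "\<not> ?thesis"
  note E = large_solution_imp_bound[of k A 2 _ 1 "real k + 3", folded L_def]
  have log48: "log 2 (4::real) = 2" "log 2 (8::real) = 3"
    using log_of_power_eq[of 4 2 2] log_of_power_eq[of 8 2 3] by auto
  have E4: "5/8 * (2 + 2 * real k * L) + 3/2 * L < real k + 3 + (real k - 2) * (L + 14/25)"
    using E[of 4] assms neg by (simp add: log48 L_def add.commute)
  have "13/16 * (2 + 2 * real k * L) + 3/4 * L < real k + 3 + (real k - 2) * (L + 39/25)"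
    using E[of 8] assms neg by (simp add: log48 L_def add.commute)
  then have E8: "5/8 * (real k * L) + 11/4 * L < 64/25 * real k - 349/200"
    by (simp add: field_simps)
  have "k \<ge> 2" using assms by simp
  then show False
  proof (cases k rule: log2_of_nat_cases)
    case 1
    then have "k = 3 \<or> k = 4 \<or> k = 5 \<or> k = 6 \<or> k = 7 \<or> k = 8 \<or> k = 9 \<or> k = 10 \<or> k = 11
      \<or> k = 12 \<or> k = 13 \<or> k = 14 \<or> k = 15"
      using \<open>k \<ge> 3\<close> by presburger
    then show False
      using 1(2-) E4 unfolding L_def[symmetric]
      by (elim disjE) (simp_all add: field_simps)
  next
    case 2
    have "real k * 4 \<le> real k * L" using 2 by (intro mult_left_mono) (auto simp: L_def)
    moreover have "L \<ge> 4" "real k \<le> 128" using 2 by (auto simp: L_def)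
    ultimately show False using E8 by linarith
  next
    case 3
    have "real k * 7 \<le> real k * L" using 3 by (intro mult_left_mono) (auto simp: L_def)
    moreover have "L \<ge> 7" "real k > 128" using 3 by (auto simp: L_def)
    ultimately show False using E8 by linarith
  qed
qed

theorem theorem2p8:
  fixes n k :: nat and a :: "nat \<Rightarrow> nat"
  assumes "k \<ge> 2" and "n > 0"
    and "\<And>i. i \<in> {1..k} \<Longrightarrow> a i > 0"
    and "strict_mono_on {1..k} a"
    and "real n / 2 ^ n = (\<Sum>i=1..k. real (a i) / 2 ^ a i)"
  shows "real (a k) \<le> 2 * real n + 2 * real k * log 2 (real k)"
proof -
  define T where "T j = (\<Sum>i=j..k. real (a i) / 2 ^ a i)" for j
  have mono: "a i < a j" if "1 \<le> i" "i < j" "j \<le> k" for i j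
    using assms(4) that by (auto simp: strict_mono_on_def)
  have mono_le: "a i \<le> a j" if "1 \<le> i" "i \<le> j" "j \<le> k" for i j
    using mono[of i j] that by (cases "i = j") auto
  have pos: "a i > 0" if "1 \<le> i" "i \<le> k" for i
    using assms(3) that by auto
  have T_pos: "T j > 0" if "1 \<le> j" "j \<le> k" for j
    unfolding T_def using that pos by (intro sum_pos) auto
  have T_less: "T j < 2 * real (a j + 1) / 2 ^ a j" if "1 \<le> j" "j \<le> k" for j
  proof -
    have "inj_on a {j..k}"
      using strict_mono_on_imp_inj_on[OF assms(4)] that by (auto elim: inj_on_subset)
    then have "T j = (\<Sum>x\<in>a ` {j..k}. real x / 2 ^ x)"
      by (simp add: T_def sum.reindex)
    also have "\<dots> < 2 * real (a j + 1) / 2 ^ a j"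
      using mono_le that by (intro sum_nat_div_power2_less) auto
    finally show ?thesis .
  qed
  have T_less': "T j < 2 * real (m + 1) / 2 ^ m" if "1 \<le> j" "j \<le> k" "m \<le> a j" for j m
    using T_less[of j] nat_add_div_power2_antimono[of m "a j" 1] that by (simp add: add_divide_distrib)
  have T_Suc: "T j = real (a j) / 2 ^ a j + T (Suc j)" if "j \<le> k" for j
    using that by (simp add: T_def sum.atLeast_Suc_atMost)
  have T1: "real n / 2 ^ n = T 1" using assms(5) by (simp add: T_def)
  have n_less: "n < a 1"
  proof (rule ccontr)
    assume "\<not> n < a 1"
    then have "real n / 2 ^ n \<le> real (a 1) / 2 ^ a 1"
      using nat_add_div_power2_antimono[of "a 1" n 0] pos[of 1] assms(1) by simp
    then show False using T1 T_Suc[of 1] T_pos[of 2] assms(1) by (simp add: numeral_2_eq_2)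
  qed
  have T_ge: "1 / 2 ^ a j \<le> T (Suc j)" if "1 \<le> j" "j < k" for j
  proof -
    \<comment> \<open>Scaling by \<open>2 ^ a j\<close> makes \<open>n / 2 ^ n\<close> and all terms
      up to index \<open>j\<close> integral, hence also the tail; being positive, the scaled tail is
      at least 1.\<close>
    have int: "2 ^ a j * (real x / 2 ^ x) \<in> \<int>" if "x \<le> a j" for x
    proof -
      have "2 ^ a j * (real x / 2 ^ x) = 2 ^ (a j - x) * real x"
        using that by (simp add: power_diff)
      then show ?thesis by simp
    qed
    have "T 1 = (\<Sum>i=1..j. real (a i) / 2 ^ a i) + T (Suc j)"
      using that sum.ub_add_nat[of 1 j "\<lambda>i. real (a i) / 2 ^ a i" "k - j"] by (simp add: T_def)
    then have "2 ^ a j * T (Suc j) =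
        2 ^ a j * (real n / 2 ^ n) - (\<Sum>i=1..j. 2 ^ a j * (real (a i) / 2 ^ a i))"
      by (simp add: T1 algebra_simps sum_distrib_left del: times_divide_eq_right)
    also have "\<dots> \<in> \<int>"
    proof (intro Ints_diff Ints_sum int)
      show "n \<le> a j" using n_less mono_le[of 1 j] that by simp
    qed (use mono_le that in auto)
    finally have "2 ^ a j * T (Suc j) \<in> \<int>" .
    moreover have "2 ^ a j * T (Suc j) > 0" using T_pos that by simp
    ultimately have "2 ^ a j * T (Suc j) \<ge> 1"
      by (metis Ints_cases of_int_0_less_iff of_int_1_le_iff int_one_le_iff_zero_less)
    then show ?thesis by (simp add: field_simps)
  qed
  \<comment> \<open>\<open>M\<close> is left open because the last tail is a single term and admits
    a smaller value.\<close>
  have gap: "real (a (Suc j)) \<le> real (a j) + log 2 M"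
    if "1 \<le> j" "j < k" "T (Suc j) \<le> M / 2 ^ a (Suc j)" for j M
  proof -
    have "1 / 2 ^ a j \<le> M / 2 ^ a (Suc j)" using T_ge[of j] that by simp
    then have M: "2 ^ a (Suc j) / 2 ^ a j \<le> M" by (simp add: field_simps)
    have "real (a (Suc j)) - real (a j) = log 2 (2 ^ a (Suc j) / 2 ^ a j)"
      by (simp add: log_divide log_nat_power)
    also have "0 < (2::real) ^ a (Suc j) / 2 ^ a j" by simp
    then have "log 2 (2 ^ a (Suc j) / 2 ^ a j) \<le> log 2 M"
      using M by (subst log_le_cancel_iff) linarith+
    finally show ?thesis by simp
  qed
  define \<Lambda> where "\<Lambda> = log 2 (real (a k))"
  have chain: "real (a (k - 1)) \<le> real (a m) + real (k - 1 - m) * (1 + \<Lambda>)" if "1 \<le> m" "m \<le> k - 1" for m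
  proof -
    have "j \<le> k - 1 \<Longrightarrow> real (a j) \<le> real (a m) + real (j - m) * (1 + \<Lambda>)" if "m \<le> j" for j
      using that
    proof (induction j rule: dec_induct)
      case base
      then show ?case by simp
    next
      case (step j)
      have "real (a (Suc j)) \<le> real (a j) + log 2 (2 * real (a (Suc j) + 1))"
        by (intro gap less_imp_le[OF T_less]) (use step \<open>1 \<le> m\<close> in linarith)+
      \<comment> \<open>Stopping before index \<open>k\<close> lets \<open>a k\<close> absorb the
        \<open>+ 1\<close> inside the logarithm.\<close>
      also have "Suc j < k" using step \<open>1 \<le> m\<close> by linarith
      then have "a (Suc j) < a k" using mono by simp
      then have "log 2 (2 * real (a (Suc j) + 1)) \<le> log 2 (2 * real (a k))"
        by (intro log_le_cancel_iff[THEN iffD2]) auto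
      also have "\<dots> = 1 + \<Lambda>"
        using pos[of k] assms(1) by (simp add: \<Lambda>_def log_mult)
      finally show ?case using step by (simp add: Suc_diff_le algebra_simps)
    qed
    then show ?thesis using that by blast
  qed
  \<comment> \<open>\<open>T k\<close> is just \<open>a k / 2 ^ a k\<close>, so
    \<open>M = a k\<close> works and the summand 1 is saved.\<close>
  have last_gap: "real (a k) \<le> real (a (k - 1)) + \<Lambda>"
    using gap[of "k - 1" "real (a k)"] assms(1) by (simp add: \<Lambda>_def T_def)
  have total: "real (a k) \<le> real (a m) + (real k - 1 - real m) * (1 + \<Lambda>) + \<Lambda>"
    if "1 \<le> m" "m < k" for m
  proof -
    have "m \<le> k - 1" "real (k - 1 - m) = real k - 1 - real m"
      using that by (auto simp: of_nat_diff)
    with chain[of m] last_gap that show ?thesis by (simp add: algebra_simps)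
  qed
  have ak: "real (a k) > 0" using pos[of k] assms(1) by simp
  show ?thesis
  proof (cases "n \<ge> 3")
    case True
    have "a 1 \<le> n + 1"
    proof (rule ccontr)
      assume "\<not> a 1 \<le> n + 1"
      \<comment> \<open>Clearing denominators gives \<open>2 * n < n + 3\<close>, impossible for
        \<open>n\<close> \<ge> 3.\<close>
      then have "real n / 2 ^ n < 2 * real (n + 2 + 1) / 2 ^ (n + 2)"
        unfolding T1 using assms(1) by (intro T_less') auto
      then show False using True by (simp add: field_simps)
    qed
    with total[of 1] assms(1) have "real (a k) \<le> real n + real k - 1 + (real k - 1) * log 2 (real (a k))"
      by (simp add: \<Lambda>_def algebra_simps)
    then show ?thesis
      using True ak assms(1) by (intro bound_of_log_inequality_large) auto
  next
    case False
    then have n: "n = 1 \<or> n = 2" using assms(2) by auto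
    then have half: "T 1 = 1/2" using T1 by auto
    \<comment> \<open>Otherwise \<open>T 1\<close> < 12/32.\<close>
    have "a 1 \<le> 4"
      using T_less'[of 1 5] half assms(1) by (cases "a 1 \<le> 4") auto
    moreover have rest: "1/2 = real (a 1) / 2 ^ a 1 + T 2" "T 2 > 0"
      using T_Suc[of 1] half T_pos[of 2] assms(1) by (auto simp: numeral_2_eq_2)
    \<comment> \<open>The value 2 would use up the whole sum 1/2, leaving
      \<open>T 2 = 0\<close>.\<close>
    ultimately have "a 1 = 3 \<or> a 1 = 4"
      using n_less n by (cases "a 1 = 2") auto
    then have "T 2 \<ge> 1/8" using rest by auto
    \<comment> \<open>Otherwise \<open>T 2\<close> < 16/128 = 1/8.\<close>
    then have a2: "a 2 \<le> 6"
      using T_less'[of 2 7] assms(1) by (cases "a 2 \<le> 6") auto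
    have "real (a k) \<le> 2 + 2 * real k * log 2 (real k)"
    proof (cases "k = 2")
      \<comment> \<open>The claimed bound is exactly 6 here, matching the bound on
        \<open>a 2\<close>.\<close>
      case True
      then show ?thesis using a2 by simp
    next
      case False
      with total[of 2] a2 assms(1) have "real (a k) \<le> real k + 3 + (real k - 2) * log 2 (real (a k))"
        by (simp add: \<Lambda>_def algebra_simps)
      then show ?thesis
        using False ak assms(1) by (intro bound_of_log_inequality_small) auto
    qed
    then show ?thesis using assms(2) by linarith
  qed
qed

end
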